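(* Let $\mathcal{G}$ be a graph class that has either bounded treewidth, bounded independence number, bounded intersection treewidth, or bounded maximum minimal separator size. Then $\mathcal{G}$ has bounded tree-independence number.
   Context: All graphs are finite, simple, and undirected. For a graph invariant $\rho$, a graph class $\mathcal{G}$ has bounded $\rho$ if there is an integer $k$ such that $\rho(G)\le k$ for every $G\in\mathcal{G}$. A tree decomposition of a graph $G$ is a pair $\mathcal{T}=(T,\{X_t\}_{t\in V(T)})$ where $T$ is a tree and each node $t$ is assigned a bag $X_t\subseteq V(G)$ such that every vertex of $G$ is in at least one bag, every edge of $G$ has both endpoints in some common bag, and for every $u\in V(G)$ the subgraph of $T$ induced by $\{t: u\in X_t\}$ is connected. Its width is $\max_t|X_t|-1$, and the treewidth of $G$ is the minimum width of a tree decomposition of $G$. The independence number of $\mathcal{T}$ is $\alpha(\mathcal{T})=\max_{t\in V(T)}\alpha(G[X_t])$, where the independence number $\alpha(H)$ of a graph $H$ is the maximum size of an independent set in $H$. The tree-independence number of $G$ is the minimum of $\alpha(\mathcal{T})$ over all tree decompositions $\mathcal{T}$ of $G$. Given a graph $H$ and connected subgraphs $H_1,\ldots,H_p$ of $H$, their intersection graph has vertex set $\{1,\ldots,p\}$, with distinct $i,j$ adjacent if and only if $H_i$ and $H_j$ have a vertex in common. A graph $G$ is representable in $H$ if $G$ is isomorphic to the intersection graph of some connected subgraphs of $H$. The intersection treewidth of $G$ is the smallest nonnegative integer $k$ such that $G$ is representable in some graph $H$ of treewidth at most $k$. For non-adjacent distinct vertices $u,v$ of $G$, a $u,v$-separator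 is a set $S\subseteq V(G)\setminus\{u,v\}$ such that $u$ and $v$ belong to different components of $G-S$; it is a minimal $u,v$-separator if no proper subset of $S$ is a $u,v$-separator. A minimal separator of $G$ is a set that is a minimal $u,v$-separator for some non-adjacent pair $u,v$. The maximum minimal separator size of $G$ is the smallest nonnegative integer $k$ such that every minimal separator of $G$ has cardinality at most $k$ (it is $0$ if $G$ is complete). *)

theory Defs
  imports "Graph_Theory.Graph_Theory"
begin

text \<open>Finite simple undirected graphs are the symmetric, loop-free, finite digraphs of
  \<^locale>\<open>pair_graph\<close>; an undirected edge is a pair of opposite arcs.\<close>

subsection \<open>Independence number\<close>

definition independent_set :: "('a, 'b) pre_digraph \<Rightarrow> 'a set \<Rightarrow> bool" where
  "independent_set G S \<longleftrightarrow> S \<subseteq> verts G \<and> (\<forall>u\<in>S. \<forall>v\<in>S. \<not> u \<rightarrow>\<^bsub>G\<^esub> v)"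

definition independence_number :: "('a, 'b) pre_digraph \<Rightarrow> nat" where
  "independence_number G = Max (card ` {S. independent_set G S})"

subsection \<open>Tree decompositions\<close>

text \<open>The library constant \<^const>\<open>tree\<close> is unsuitable for symmetric digraphs, since there every
  edge gives rise to a directed cycle of length 2. Undirected cycles are the directed cycles of
  length at least 3.\<close>

definition undirected_tree :: "'t pair_pre_digraph \<Rightarrow> bool" where
  "undirected_tree T \<longleftrightarrow> pair_graph T \<and> connected (with_proj T) \<and>
     \<not> (\<exists>p. pre_digraph.cycle (with_proj T) p \<and> 3 \<le> length p)"

definition tree_decomposition ::
  "'a pair_pre_digraph \<Rightarrow> 't pair_pre_digraph \<Rightarrow> ('t \<Rightarrow> 'a set) \<Rightarrow> bool" where
  "tree_decomposition G T X \<longleftrightarrow>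
     undirected_tree T \<and>
     (\<forall>t\<in>pverts T. X t \<subseteq> pverts G) \<and>
     (\<forall>u\<in>pverts G. \<exists>t\<in>pverts T. u \<in> X t) \<and>
     (\<forall>(u, v)\<in>parcs G. \<exists>t\<in>pverts T. u \<in> X t \<and> v \<in> X t) \<and>
     (\<forall>u\<in>pverts G. connected (with_proj T \<restriction> {t \<in> pverts T. u \<in> X t}))"

definition decomposition_width :: "'t pair_pre_digraph \<Rightarrow> ('t \<Rightarrow> 'a set) \<Rightarrow> int" where
  "decomposition_width T X = Max ((\<lambda>t. int (card (X t))) ` pverts T) - 1"

definition decomposition_independence_number ::
  "'a pair_pre_digraph \<Rightarrow> 't pair_pre_digraph \<Rightarrow> ('t \<Rightarrow> 'a set) \<Rightarrow> nat" where
  "decomposition_independence_number G T X =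
     Max ((\<lambda>t. independence_number (with_proj G \<restriction> X t)) ` pverts T)"

text \<open>As trees are finite, it is no restriction to take their nodes to be natural numbers; the
  same applies to the host graphs below. The graph without vertices has treewidth \<open>-1\<close>.\<close>

definition treewidth :: "'a pair_pre_digraph \<Rightarrow> int" where
  "treewidth G = (LEAST w. \<exists>(T :: nat pair_pre_digraph) X.
     tree_decomposition G T X \<and> decomposition_width T X = w)"

definition tree_independence_number :: "'a pair_pre_digraph \<Rightarrow> nat" where
  "tree_independence_number G = (LEAST k. \<exists>(T :: nat pair_pre_digraph) X.
     tree_decomposition G T X \<and> decomposition_independence_number G T X = k)"

subsection \<open>Intersection treewidth\<close>

definition connected_subgraph :: "'h pair_pre_digraph \<Rightarrow> 'h pair_pre_digraph \<Rightarrow> bool" where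
  "connected_subgraph K H \<longleftrightarrow>
     pair_graph K \<and> subgraph (with_proj K) (with_proj H) \<and> connected (with_proj K)"

definition intersection_graph ::
  "nat \<Rightarrow> (nat \<Rightarrow> 'h pair_pre_digraph) \<Rightarrow> nat pair_pre_digraph" where
  "intersection_graph p Hs =
     \<lparr> pverts = {1..p},
       parcs = {(i, j). i \<in> {1..p} \<and> j \<in> {1..p} \<and> i \<noteq> j \<and>
                        pverts (Hs i) \<inter> pverts (Hs j) \<noteq> {}} \<rparr>"

definition representable_in :: "'a pair_pre_digraph \<Rightarrow> 'h pair_pre_digraph \<Rightarrow> bool" where
  "representable_in G H \<longleftrightarrow> (\<exists>p Hs. (\<forall>i\<in>{1..p}. connected_subgraph (Hs i) H) \<and>
     digraph_iso (with_proj G) (with_proj (intersection_graph p Hs)))"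

definition intersection_treewidth :: "'a pair_pre_digraph \<Rightarrow> nat" where
  "intersection_treewidth G = (LEAST k. \<exists>H :: nat pair_pre_digraph.
     pair_graph H \<and> treewidth H \<le> int k \<and> representable_in G H)"

subsection \<open>Minimal separators\<close>

text \<open>In a symmetric digraph the strongly connected components are the connected components.\<close>

definition separator :: "'a pair_pre_digraph \<Rightarrow> 'a \<Rightarrow> 'a \<Rightarrow> 'a set \<Rightarrow> bool" where
  "separator G u v S \<longleftrightarrow>
     u \<in> pverts G \<and> v \<in> pverts G \<and> u \<noteq> v \<and> (u, v) \<notin> parcs G \<and>
     S \<subseteq> pverts G - {u, v} \<and>
     (\<exists>C \<in> pre_digraph.sccs_verts (with_proj G \<restriction> (pverts G - S)).
      \<exists>D \<in> pre_digraph.sccs_verts (with_proj G \<restriction> (pverts G - S)).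
        u \<in> C \<and> v \<in> D \<and> C \<noteq> D)"

definition minimal_separator_between ::
  "'a pair_pre_digraph \<Rightarrow> 'a \<Rightarrow> 'a \<Rightarrow> 'a set \<Rightarrow> bool" where
  "minimal_separator_between G u v S \<longleftrightarrow>
     separator G u v S \<and> (\<forall>S'. S' \<subset> S \<longrightarrow> \<not> separator G u v S')"

definition minimal_separator :: "'a pair_pre_digraph \<Rightarrow> 'a set \<Rightarrow> bool" where
  "minimal_separator G S \<longleftrightarrow> (\<exists>u v. minimal_separator_between G u v S)"

definition max_minimal_separator_size :: "'a pair_pre_digraph \<Rightarrow> nat" where
  "max_minimal_separator_size G = (LEAST k. \<forall>S. minimal_separator G S \<longrightarrow> card S \<le> k)"

subsection \<open>Boundedness of invariants\<close>

definition has_bounded ::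
  "('a pair_pre_digraph \<Rightarrow> int) \<Rightarrow> 'a pair_pre_digraph set \<Rightarrow> bool" where
  "has_bounded \<rho> \<G> \<longleftrightarrow> (\<exists>k. \<forall>G\<in>\<G>. \<rho> G \<le> k)"

end

theory Submission
  imports Defs
begin

text \<open>
  A bag \<open>X\<^sub>t\<close> has independence number at most \<open>|X\<^sub>t|\<close>, and one bag containing all vertices is always
  available; this settles bounded treewidth and bounded independence number. If \<open>G\<close> is the
  intersection graph of connected subgraphs \<open>H\<^sub>v\<close> of \<open>H\<close>, a tree decomposition \<open>X\<close> of \<open>H\<close> yields the
  bags \<open>{v. H\<^sub>v \<inter> X\<^sub>t \<noteq> {}}\<close> for \<open>G\<close>, whose independent sets inject into \<open>X\<^sub>t\<close>.

  Suppose now that all minimal separators have size at most \<open>k\<close>. The torso of \<open>A \<subseteq> V(G)\<close> is \<open>G[A]\<close>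
  with the neighbourhood of every component of \<open>G - A\<close> made complete. If two vertices of \<open>A\<close> are
  non-adjacent in the torso, they have a minimal separator \<open>S \<subseteq> A\<close> in \<open>G\<close>; it cuts \<open>A\<close> into two
  smaller parts in whose torsos \<open>S\<close> is a clique, so their decompositions can be glued along \<open>S\<close>, and
  every component outside a part still has its neighbourhood inside some minimal separator. The
  process ends with parts whose torso is complete. Let \<open>I\<close> be independent in such a part \<open>A\<close>, and
  let \<open>S\<close> be a minimal separator of two of its vertices \<open>u\<close>, \<open>v\<close>. A vertex \<open>w \<in> I\<close> outside \<open>S\<close> is
  separated by \<open>S\<close> from one of \<open>u\<close> and \<open>v\<close>, but it shares a component of \<open>G - A\<close> with each of them,
  so \<open>S\<close> meets a component next to \<open>w\<close>. Each element of \<open>S\<close> thus accounts for at most \<open>k\<close> vertices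
  of \<open>I\<close>, and \<open>|I| \<le> k\<^sup>2\<close>.
\<close>

section \<open>Connected induced subgraphs\<close>

lemma arcs_ends_induce [simp]: "arcs_ends (with_proj G \<restriction> B) = Restr (parcs G) B"
  by (force simp: arcs_ends_conv)

lemma (in sym_digraph) connected_iff_reachable_from:
  assumes "r \<in> verts G"
  shows "connected G \<longleftrightarrow> (\<forall>x\<in>verts G. r \<rightarrow>\<^sup>* x)"
proof
  assume "connected G"
  then have "strongly_connected G"
    using sym_arcs symmetric_connected_imp_strongly_connected by blast
  then show "\<forall>x\<in>verts G. r \<rightarrow>\<^sup>* x"
    using assms by (simp add: strongly_connected_def)
next
  assume "\<forall>x\<in>verts G. r \<rightarrow>\<^sup>* x"
  then have "x \<rightarrow>\<^sup>*\<^bsub>mk_symmetric G\<^esub> y" if "x \<in> verts G" "y \<in> verts G" for x y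
    using that by (meson reachable_mk_symmetricI reachable_trans symmetric_reachable')
  then show "connected G"
    using assms unfolding connected_def by (intro strongly_connectedI) auto
qed

lemma pair_graphI:
  assumes "finite (pverts G)" "parcs G \<subseteq> pverts G \<times> pverts G" "sym (parcs G)" "irrefl (parcs G)"
  shows "pair_graph G"
proof -
  have "finite (parcs G)"
    using assms by (meson finite_SigmaI finite_subset)
  with assms show ?thesis
    by unfold_locales (auto simp: symmetric_def irrefl_def)
qed

lemma connected_nonempty: "connected G \<Longrightarrow> verts G \<noteq> {}"
  by (auto simp: connected_def strongly_connected_def)

context pair_graph
begin

lemma sym_digraph_induce: "B \<subseteq> pverts G \<Longrightarrow> sym_digraph (with_proj G \<restriction> B)"
  by (intro induced_graph_imp_graph induced_induce)

lemma induce_pverts: "with_proj G \<restriction> pverts G = with_proj G"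
  using induce_eq_iff_induced[OF induced_subgraph_refl] by simp

lemma connected_induce_iff:
  assumes "B \<subseteq> pverts G" "r \<in> B"
  shows "connected (with_proj G \<restriction> B) \<longleftrightarrow> (\<forall>x\<in>B. r \<rightarrow>\<^sup>*\<^bsub>with_proj G \<restriction> B\<^esub> x)"
  using sym_digraph.connected_iff_reachable_from[OF sym_digraph_induce] assms by auto

lemma connected_induce_UN:
  assumes K: "wf_digraph K" "strongly_connected K"
    and N: "\<And>h. h \<in> verts K \<Longrightarrow> N h \<subseteq> pverts G"
      "\<And>h. h \<in> verts K \<Longrightarrow> connected (with_proj G \<restriction> N h)"
    and meet: "\<And>h h'. h \<rightarrow>\<^bsub>K\<^esub> h' \<Longrightarrow> N h \<inter> N h' \<noteq> {}"
  shows "connected (with_proj G \<restriction> (\<Union>h\<in>verts K. N h))"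
proof -
  interpret K: wf_digraph K by fact
  let ?B = "\<Union>h\<in>verts K. N h"
  interpret B: sym_digraph "with_proj G \<restriction> ?B"
    using N(1) by (intro sym_digraph_induce) blast
  have within: "x \<rightarrow>\<^sup>*\<^bsub>with_proj G \<restriction> ?B\<^esub> y" if "h \<in> verts K" "x \<in> N h" "y \<in> N h" for h x y
    using N that connected_induce_iff[of "N h" x] reachable_induce_ss[of "N h" x y ?B] by blast
  obtain h\<^sub>0 where h\<^sub>0: "h\<^sub>0 \<in> verts K"
    using K(2) by (auto simp: strongly_connected_def)
  moreover obtain r where r: "r \<in> N h\<^sub>0"
    using connected_nonempty[OF N(2)[OF h\<^sub>0]] by auto
  moreover have "\<forall>x\<in>N h. r \<rightarrow>\<^sup>*\<^bsub>with_proj G \<restriction> ?B\<^esub> x" if "h \<in> verts K" for h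
  proof -
    have "h\<^sub>0 \<rightarrow>\<^sup>*\<^bsub>K\<^esub> h"
      using K(2) h\<^sub>0 that by (simp add: strongly_connected_def)
    then show ?thesis
    proof (induction rule: K.reachable_induct)
      case base
      then show ?case using within r by blast
    next
      case (step h h')
      then obtain x where "x \<in> N h" "x \<in> N h'" "h' \<in> verts K"
        using meet K.adj_in_verts(2) by blast
      then show ?case using within B.reachable_trans step.IH by blast
    qed
  qed
  ultimately show ?thesis
    using N(1) by (subst connected_induce_iff[of _ r]) auto
qed

lemma long_cycle_two_neighbours:
  assumes walk: "awalk u es u" and dist: "distinct (tl (pawalk_verts u es))"
    and len: "3 \<le> length es" and x: "x \<in> set (pawalk_verts u es)"
  obtains y z where "(y, x) \<in> parcs G" "(x, z) \<in> parcs G" "y \<noteq> z"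
proof -
  obtain q r where es: "es = q @ r" and closed: "awalk x (r @ q) x"
    using rotate_awalkE[OF walk x] .
  have "tl (pawalk_verts u es) = map snd es"
    using awalk_verts_conv'[of u es u] walk len by (auto simp: awalk_def)
  then have snds: "distinct (map snd (r @ q))"
    using dist es by auto
  obtain a c es' where rq: "r @ q = a # es' @ [c]" and "es' \<noteq> []"
  proof -
    have "3 \<le> length (r @ q)" using len es by simp
    then show ?thesis
      using that by (cases "r @ q" rule: list.exhaust; cases "tl (r @ q)" rule: rev_cases)
        (auto simp: Suc_le_eq)
  qed
  have ends: "fst a = x" "snd c = x" and arcs: "a \<in> parcs G" "c \<in> parcs G"
    and inner: "awalk (snd a) es' (fst c)"
    using closed unfolding rq by (auto simp: awalk_simps)
  have "fst c = last (pawalk_verts (snd a) es')"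
    using inner awlast_if_cas by (auto simp: awalk_def)
  also have "\<dots> = last (map snd es')"
    using inner \<open>es' \<noteq> []\<close> awalk_verts_conv'[of "snd a" es' "fst c"] by (simp add: awalk_def)
  also have "\<dots> \<in> set (map snd es')"
    using \<open>es' \<noteq> []\<close> by (intro last_in_set) simp
  finally have "fst c \<in> set (map snd es')" .
  moreover have "snd a \<notin> set (map snd es')"
    using snds unfolding rq by simp
  ultimately have "fst c \<noteq> snd a" by metis
  then show ?thesis
    using that[of "fst c" "snd a"] ends arcs by (metis prod.collapse)
qed

end

section \<open>Tree decompositions with the running intersection property\<close>

definition insert_leaf :: "'t \<Rightarrow> 't \<Rightarrow> 't pair_pre_digraph \<Rightarrow> 't pair_pre_digraph" where
  "insert_leaf n t T = \<lparr>pverts = insert n (pverts T), parcs = parcs T \<union> {(n, t), (t, n)}\<rparr>"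

lemma insert_leaf_simps [simp]:
  "pverts (insert_leaf n t T) = insert n (pverts T)"
  "parcs (insert_leaf n t T) = parcs T \<union> {(n, t), (t, n)}"
  by (simp_all add: insert_leaf_def)

lemma connected_induce_singleton: "connected (with_proj G \<restriction> {x})"
  by (auto simp: connected_def strongly_connected_def reachable_def)

locale leaf_insertion = pair_graph T for T :: "'t pair_pre_digraph" +
  fixes n t
  assumes parent_in_pverts: "t \<in> pverts T" and leaf_notin_pverts: "n \<notin> pverts T"
begin

lemma pair_graph_insert_leaf: "pair_graph (insert_leaf n t T)"
  using parent_in_pverts leaf_notin_pverts arcs_symmetric no_loops' wellformed'
  by (intro pair_graphI) (auto simp: sym_def irrefl_def)

lemma induce_insert_leaf:
  assumes "n \<notin> B"
  shows "with_proj (insert_leaf n t T) \<restriction> B = with_proj T \<restriction> B"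
  using assms by (auto simp: induce_subgraph_def)

lemma connected_induce_insert_leaf:
  assumes B: "B \<subseteq> pverts T" "t \<in> B" and conn: "connected (with_proj T \<restriction> B)"
  shows "connected (with_proj (insert_leaf n t T) \<restriction> insert n B)"
proof -
  let ?L = "with_proj (insert_leaf n t T) \<restriction> insert n B"
  interpret L: pair_graph "insert_leaf n t T" by (rule pair_graph_insert_leaf)
  interpret B: sym_digraph ?L
    using B by (intro L.sym_digraph_induce) auto
  have "t \<rightarrow>\<^sup>*\<^bsub>?L\<^esub> x" if "x \<in> B" for x
  proof -
    have "t \<rightarrow>\<^sup>*\<^bsub>with_proj (insert_leaf n t T) \<restriction> B\<^esub> x"
      using conn that induce_insert_leaf connected_induce_iff[OF B] B(1) leaf_notin_pverts
      by (metis subsetD)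
    then show ?thesis
      by (rule L.reachable_induce_ss) blast
  qed
  moreover have "t \<rightarrow>\<^sup>*\<^bsub>?L\<^esub> n"
    using B by (intro B.reachable_adjI) auto
  ultimately show ?thesis
    using B by (subst L.connected_induce_iff[of _ t]) auto
qed

lemma connected_induce_insert_leaf_if:
  assumes "N \<subseteq> pverts T" "N \<noteq> {} \<Longrightarrow> connected (with_proj T \<restriction> N)"
    and "b \<Longrightarrow> N \<noteq> {} \<Longrightarrow> t \<in> N" "b \<or> N \<noteq> {}"
  shows "connected (with_proj (insert_leaf n t T) \<restriction> (if b then insert n N else N))"
proof (cases "N = {}")
  case True
  with assms(4) show ?thesis by (simp add: connected_induce_singleton)
next
  case False
  moreover have "n \<notin> N"
    using assms(1) leaf_notin_pverts by blast
  ultimately show ?thesis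
    using assms connected_induce_insert_leaf[of N] induce_insert_leaf[of N] by simp
qed

lemma long_cycle_insert_leaf:
  assumes "pre_digraph.cycle (with_proj (insert_leaf n t T)) es" and len: "3 \<le> length es"
  shows "cycle es"
proof -
  interpret L: pair_graph "insert_leaf n t T" by (rule pair_graph_insert_leaf)
  obtain u where walk: "L.awalk u es u" and dist: "distinct (tl (pawalk_verts u es))"
    using assms(1) by (auto simp: L.cycle_def)
  have leaf: "n \<notin> set (pawalk_verts u es)"
  proof
    assume "n \<in> set (pawalk_verts u es)"
    then obtain y z where "y \<noteq> z"
      "(y, n) \<in> parcs (insert_leaf n t T)" "(n, z) \<in> parcs (insert_leaf n t T)"
      using L.long_cycle_two_neighbours[OF walk dist len] by metis
    then show False
      using leaf_notin_pverts wellformed' by auto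
  qed
  have "set es \<subseteq> parcs T"
  proof
    fix e assume e: "e \<in> set es"
    then have "e \<in> parcs (insert_leaf n t T)"
      using walk by (auto simp: L.awalk_def)
    moreover have "fst e \<noteq> n" "snd e \<noteq> n"
      using e walk leaf by (auto simp: L.set_awalk_verts)
    ultimately show "e \<in> parcs T" by (cases e) auto
  qed
  then have "awalk u es u"
    using walk leaf L.hd_in_awalk_verts(1)[OF walk] by (auto simp: awalk_def L.awalk_def)
  then show ?thesis
    using dist len by (auto simp: cycle_def)
qed

lemma undirected_tree_insert_leaf:
  assumes "undirected_tree T"
  shows "undirected_tree (insert_leaf n t T)"
  unfolding undirected_tree_def
proof (intro conjI notI)
  interpret L: pair_graph "insert_leaf n t T" by (rule pair_graph_insert_leaf)
  show "pair_graph (insert_leaf n t T)" ..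
  have "connected (with_proj (insert_leaf n t T) \<restriction> insert n (pverts T))"
    using assms parent_in_pverts
    by (intro connected_induce_insert_leaf) (simp_all add: undirected_tree_def induce_pverts)
  then show "connected (with_proj (insert_leaf n t T))"
    using L.induce_pverts by simp
  assume "\<exists>es. L.cycle es \<and> 3 \<le> length es"
  then show False
    using assms long_cycle_insert_leaf by (auto simp: undirected_tree_def)
qed

end

inductive running_intersection :: "'a set list \<Rightarrow> bool" where
  singleton: "running_intersection [B]"
| snoc: "running_intersection Bs \<Longrightarrow> C \<in> set Bs \<Longrightarrow> B \<inter> \<Union>(set Bs) \<subseteq> C \<Longrightarrow>
    running_intersection (Bs @ [B])"

lemma running_intersection_nonempty: "running_intersection Bs \<Longrightarrow> Bs \<noteq> []"
  by (induction rule: running_intersection.induct) auto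

lemma running_intersection_append:
  assumes As: "running_intersection As" and C: "C \<in> set As"
    and "running_intersection Bs" and "\<Union>(set As) \<inter> \<Union>(set Bs) \<subseteq> C \<inter> hd Bs"
  shows "running_intersection (As @ Bs)"
  using assms(3,4)
proof (induction rule: running_intersection.induct)
  case (singleton B)
  then show ?case
    using running_intersection.snoc[OF As C, of B] by (auto simp: Int_commute)
next
  case (snoc Bs D B)
  have hd: "hd (Bs @ [B]) = hd Bs" "hd Bs \<in> set Bs"
    using running_intersection_nonempty[OF snoc.hyps(1)] by auto
  have "running_intersection (As @ Bs)"
    using snoc.IH snoc.prems hd(1) by (simp add: Int_Un_distrib)
  moreover have "B \<inter> \<Union>(set (As @ Bs)) \<subseteq> D"
    using snoc.prems snoc.hyps(3) hd by fastforce
  ultimately have "running_intersection ((As @ Bs) @ [B])"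
    using snoc.hyps(2) by (intro running_intersection.snoc[of _ D]) auto
  then show ?case by simp
qed

lemma undirected_tree_singleton: "undirected_tree \<lparr>pverts = {t}, parcs = {}\<rparr>"
proof -
  let ?T = "\<lparr>pverts = {t}, parcs = {}\<rparr>"
  interpret pair_graph ?T
    by (rule pair_graphI) (auto simp: sym_def irrefl_def)
  have "connected (with_proj ?T)"
    using connected_induce_singleton[of ?T t] induce_pverts by (simp only: pair_pre_digraph.simps)
  moreover have "\<not> cycle es" for es
    by (auto simp: cycle_def awalk_def)
  ultimately show ?thesis
    using pair_graph by (simp add: undirected_tree_def)
qed

lemma running_intersection_tree:
  assumes "running_intersection Bs"
  shows "\<exists>T. undirected_tree T \<and> pverts T = {..<length Bs} \<and>
    (\<forall>u\<in>\<Union>(set Bs). connected (with_proj T \<restriction> {i\<in>pverts T. u \<in> Bs ! i}))"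
  using assms
proof (induction rule: running_intersection.induct)
  case (singleton B)
  let ?T = "\<lparr>pverts = {0}, parcs = {}\<rparr> :: nat pair_pre_digraph"
  have "{i. i = 0 \<and> u \<in> [B] ! i} = {0}" if "u \<in> B" for u
    using that by auto
  then show ?case
    using undirected_tree_singleton
    by (intro exI[of _ ?T]) (auto simp: connected_induce_singleton)
next
  case (snoc Bs C B)
  define n where "n = length Bs"
  obtain T where T: "undirected_tree T" and nodes: "pverts T = {..<n}"
    and conn: "\<And>u. u \<in> \<Union>(set Bs) \<Longrightarrow> connected (with_proj T \<restriction> {i\<in>pverts T. u \<in> Bs ! i})"
    using snoc.IH unfolding n_def by blast
  obtain t where t: "t < n" "Bs ! t = C"
    using snoc.hyps(2) unfolding n_def in_set_conv_nth by blast
  interpret T: pair_graph T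
    using T by (simp add: undirected_tree_def)
  interpret leaf_insertion T n t
    using t nodes by unfold_locales auto
  have "connected (with_proj (insert_leaf n t T) \<restriction> {i\<in>insert n {..<n}. u \<in> (Bs @ [B]) ! i})"
    if u: "u \<in> \<Union>(set (Bs @ [B]))" for u
  proof -
    let ?N = "{i\<in>pverts T. u \<in> Bs ! i}"
    have nodes_new: "{i\<in>insert n {..<n}. u \<in> (Bs @ [B]) ! i} = (if u \<in> B then insert n ?N else ?N)"
      by (auto simp: nth_append n_def nodes)
    have nonempty: "?N \<noteq> {} \<longleftrightarrow> u \<in> \<Union>(set Bs)"
      unfolding nodes n_def by (auto simp: in_set_conv_nth) (metis nth_mem)
    show ?thesis
      unfolding nodes_new
    proof (rule connected_induce_insert_leaf_if)
      show "t \<in> ?N" if "u \<in> B" "?N \<noteq> {}"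
        using that snoc.hyps(3) t nodes nonempty by auto
      show "connected (with_proj T \<restriction> ?N)" if "?N \<noteq> {}"
        using that nonempty conn by simp
      show "u \<in> B \<or> ?N \<noteq> {}"
        using u nonempty by auto
    qed blast
  qed
  then show ?case
    using undirected_tree_insert_leaf[OF T] nodes
    by (intro exI[of _ "insert_leaf n t T"]) (auto simp: n_def)
qed

lemma tree_decomposition_of_running_intersection:
  assumes "running_intersection Bs" "\<Union>(set Bs) = pverts G"
    and arcs: "\<And>u v. (u, v) \<in> parcs G \<Longrightarrow> \<exists>B\<in>set Bs. u \<in> B \<and> v \<in> B"
  obtains T where "tree_decomposition G T ((!) Bs)" "pverts T = {..<length Bs}"
proof -
  obtain T where T: "undirected_tree T" "pverts T = {..<length Bs}"
    "\<forall>u\<in>\<Union>(set Bs). connected (with_proj T \<restriction> {i\<in>pverts T. u \<in> Bs ! i})"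
    using running_intersection_tree[OF assms(1)] by blast
  have "set Bs = (!) Bs ` pverts T"
    using T(2) by (auto simp: set_conv_nth)
  then have bags: "\<exists>i\<in>pverts T. P (Bs ! i)" if "\<exists>B\<in>set Bs. P B" for P
    using that by auto
  have "tree_decomposition G T ((!) Bs)"
    unfolding tree_decomposition_def
  proof (intro conjI ballI)
    show "\<exists>i\<in>pverts T. u \<in> Bs ! i" if "u \<in> pverts G" for u
      using that assms(2) by (intro bags) auto
    show "case e of (u, v) \<Rightarrow> \<exists>i\<in>pverts T. u \<in> Bs ! i \<and> v \<in> Bs ! i" if "e \<in> parcs G" for e
      using that arcs by (cases e) (auto intro!: bags)
    show "Bs ! i \<subseteq> pverts G" if "i \<in> pverts T" for i
      using that T(2) assms(2) nth_mem by auto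
  qed (use T assms(2) in auto)
  then show ?thesis
    using T(2) by (rule that)
qed

section \<open>Independence number and treewidth\<close>

lemma independence_number_le_iff:
  assumes "finite (verts G)"
  shows "independence_number G \<le> b \<longleftrightarrow> (\<forall>S. independent_set G S \<longrightarrow> card S \<le> b)"
proof -
  have "finite {S. independent_set G S}"
    by (rule finite_subset[of _ "Pow (verts G)"]) (auto simp: independent_set_def assms)
  moreover have "independent_set G {}"
    by (simp add: independent_set_def)
  ultimately show ?thesis
    unfolding independence_number_def by (subst Max_le_iff) auto
qed

lemma independent_set_induce_iff:
  "X \<subseteq> pverts G \<Longrightarrow>
    independent_set (with_proj G \<restriction> X) S \<longleftrightarrow> S \<subseteq> X \<and> independent_set (with_proj G) S"
  by (simp add: independent_set_def) (meson subset_eq)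

lemma tree_decomposition_finite_nonempty:
  assumes "tree_decomposition G T X"
  shows "finite (pverts T)" "pverts T \<noteq> {}"
proof -
  interpret T: pair_graph T
    using assms by (simp add: tree_decomposition_def undirected_tree_def)
  show "finite (pverts T)" by (rule T.pair_finite_verts)
  show "pverts T \<noteq> {}"
    using assms connected_nonempty[of "with_proj T"]
    by (auto simp: tree_decomposition_def undirected_tree_def)
qed

lemma card_bag_le_decomposition_width:
  assumes "tree_decomposition G T X" "t \<in> pverts T"
  shows "int (card (X t)) \<le> decomposition_width T X + 1"
proof -
  have "int (card (X t)) \<le> Max ((\<lambda>t. int (card (X t))) ` pverts T)"
    using tree_decomposition_finite_nonempty(1) assms by (intro Max_ge) auto
  then show ?thesis
    by (simp add: decomposition_width_def)
qed

lemma LeastI_int_bounded_below: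
  fixes P :: "int \<Rightarrow> bool"
  assumes "P w" and lb: "\<And>w. P w \<Longrightarrow> c \<le> w"
  shows "P (LEAST w. P w)"
proof -
  obtain m where m: "P m" "\<And>w. P w \<Longrightarrow> nat (m - c) \<le> nat (w - c)"
    using ex_has_least_nat[of P w "\<lambda>w. nat (w - c)"] assms(1) by blast
  have "m \<le> w" if "P w" for w
    using m(2)[OF that] lb[OF that] by linarith
  then have "(LEAST w. P w) = m"
    using m(1) by (intro Least_equality)
  with m show ?thesis by simp
qed

context pair_graph
begin

lemma finite_bag:
  assumes "tree_decomposition G T X" "t \<in> pverts T"
  shows "finite (X t)"
proof -
  have "X t \<subseteq> pverts G"
    using assms by (simp add: tree_decomposition_def)
  then show ?thesis
    using pair_finite_verts by (rule finite_subset)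
qed

lemma tree_independence_number_le:
  fixes T :: "nat pair_pre_digraph"
  assumes td: "tree_decomposition G T X"
    and bound: "\<And>t I. t \<in> pverts T \<Longrightarrow> I \<subseteq> X t \<Longrightarrow> independent_set (with_proj G) I \<Longrightarrow> card I \<le> b"
  shows "tree_independence_number G \<le> b"
proof -
  have "tree_independence_number G \<le> decomposition_independence_number G T X"
    unfolding tree_independence_number_def by (rule Least_le) (use td in blast)
  also have "\<dots> \<le> b"
  proof -
    have "independence_number (with_proj G \<restriction> X t) \<le> b" if t: "t \<in> pverts T" for t
    proof -
      have "X t \<subseteq> pverts G"
        using td t by (simp add: tree_decomposition_def)
      then show ?thesis
        using bound[OF t] finite_bag[OF td t]
        by (simp add: independence_number_le_iff independent_set_induce_iff)
    qed
    then show ?thesis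
      unfolding decomposition_independence_number_def
      using tree_decomposition_finite_nonempty[OF td] by (subst Max_le_iff) auto
  qed
  finally show ?thesis .
qed

lemma tree_independence_number_le_running_intersection:
  assumes Bs: "running_intersection Bs" "\<Union>(set Bs) = pverts G"
    and arcs: "\<And>u v. (u, v) \<in> parcs G \<Longrightarrow> \<exists>B\<in>set Bs. u \<in> B \<and> v \<in> B"
    and bound: "\<And>B I. B \<in> set Bs \<Longrightarrow> I \<subseteq> B \<Longrightarrow> independent_set (with_proj G) I \<Longrightarrow> card I \<le> b"
  shows "tree_independence_number G \<le> b"
proof -
  obtain T where T: "tree_decomposition G T ((!) Bs)" "pverts T = {..<length Bs}"
    using tree_decomposition_of_running_intersection[OF Bs arcs] .
  show ?thesis
    using T(2) bound nth_mem by (intro tree_independence_number_le[OF T(1)]) fastforce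
qed

lemma tree_independence_number_le_independence_number:
  "tree_independence_number G \<le> independence_number (with_proj G)"
proof (rule tree_independence_number_le_running_intersection[of "[pverts G]"])
  show "running_intersection [pverts G]"
    by (rule running_intersection.singleton)
  show "card I \<le> independence_number (with_proj G)" if "independent_set (with_proj G) I" for I
    using that independence_number_le_iff[of "with_proj G" "independence_number (with_proj G)"]
    by simp
qed (auto dest: wellformed')

lemma treewidth_attained:
  obtains T :: "nat pair_pre_digraph" and X
  where "tree_decomposition G T X" "decomposition_width T X = treewidth G"
proof -
  let ?P = "\<lambda>w. \<exists>(T :: nat pair_pre_digraph) X.
    tree_decomposition G T X \<and> decomposition_width T X = w"
  obtain T where "tree_decomposition G T ((!) [pverts G])"
    by (rule tree_decomposition_of_running_intersection[of "[pverts G]" G])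
      (auto intro: running_intersection.singleton dest: wellformed')
  then have "?P (decomposition_width T ((!) [pverts G]))"
    by blast
  moreover have "- 1 \<le> w" if "?P w" for w
    using that card_bag_le_decomposition_width tree_decomposition_finite_nonempty(2) by fastforce
  ultimately have "?P (treewidth G)"
    unfolding treewidth_def by (rule LeastI_int_bounded_below)
  then show ?thesis
    using that by blast
qed

lemma tree_independence_number_le_treewidth:
  "int (tree_independence_number G) \<le> treewidth G + 1"
proof -
  obtain T :: "nat pair_pre_digraph" and X where td: "tree_decomposition G T X"
    and "decomposition_width T X = treewidth G"
    using treewidth_attained .
  then have width: "int (card (X t)) \<le> treewidth G + 1" if "t \<in> pverts T" for t
    using card_bag_le_decomposition_width that by metis
  have "tree_independence_number G \<le> nat (treewidth G + 1)"
  proof (rule tree_independence_number_le[OF td])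
    fix t I assume t: "t \<in> pverts T" and "I \<subseteq> X t"
    then have "card I \<le> card (X t)"
      using finite_bag[OF td t] by (simp add: card_mono)
    with width[OF t] show "card I \<le> nat (treewidth G + 1)" by linarith
  qed
  moreover have "0 \<le> treewidth G + 1"
    using width tree_decomposition_finite_nonempty(2)[OF td] by force
  ultimately show ?thesis by linarith
qed

end

section \<open>Minimal separators\<close>

definition reachable_avoiding :: "'a pair_pre_digraph \<Rightarrow> 'a set \<Rightarrow> 'a \<Rightarrow> 'a \<Rightarrow> bool" where
  "reachable_avoiding G Z x y \<longleftrightarrow> x \<rightarrow>\<^sup>*\<^bsub>with_proj G \<restriction> (pverts G - Z)\<^esub> y"

context pair_graph
begin

lemma sym_digraph_avoiding: "sym_digraph (with_proj G \<restriction> (pverts G - Z))"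
  by (intro sym_digraph_induce) blast

lemma reachable_avoiding_refl_iff [simp]: "reachable_avoiding G Z x x \<longleftrightarrow> x \<in> pverts G - Z"
  unfolding reachable_avoiding_def reachable_def by (auto dest: in_rtrancl_on_in_F)

lemma reachable_avoiding_in_pverts:
  assumes "reachable_avoiding G Z x y"
  shows "x \<in> pverts G - Z" "y \<in> pverts G - Z"
  using assms unfolding reachable_avoiding_def by (auto elim: reachable_in_vertsE)

lemma reachable_avoiding_sym: "reachable_avoiding G Z x y \<Longrightarrow> reachable_avoiding G Z y x"
  unfolding reachable_avoiding_def
  by (rule sym_digraph.symmetric_reachable'[OF sym_digraph_avoiding])

lemma reachable_avoiding_trans:
  assumes "reachable_avoiding G Z x y" "reachable_avoiding G Z y z"
  shows "reachable_avoiding G Z x z"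
proof -
  interpret H: sym_digraph "with_proj G \<restriction> (pverts G - Z)" by (rule sym_digraph_avoiding)
  show ?thesis
    using assms H.reachable_trans unfolding reachable_avoiding_def by blast
qed

lemma reachable_avoiding_arc:
  assumes "(x, y) \<in> parcs G" "x \<notin> Z" "y \<notin> Z"
  shows "reachable_avoiding G Z x y"
proof -
  interpret H: sym_digraph "with_proj G \<restriction> (pverts G - Z)" by (rule sym_digraph_avoiding)
  show ?thesis
    using assms wellformed' unfolding reachable_avoiding_def by (intro H.reachable_adjI) auto
qed

lemma reachable_avoiding_step:
  assumes "reachable_avoiding G Z x y" "(y, z) \<in> parcs G" "z \<notin> Z"
  shows "reachable_avoiding G Z x z"
  using assms reachable_avoiding_in_pverts reachable_avoiding_arc reachable_avoiding_trans
  by (metis DiffD2)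

lemma reachable_avoiding_induct [consumes 1, case_names base step]:
  assumes "reachable_avoiding G Z x y"
    and "x \<in> pverts G \<Longrightarrow> x \<notin> Z \<Longrightarrow> P x"
    and "\<And>y z. reachable_avoiding G Z x y \<Longrightarrow> (y, z) \<in> parcs G \<Longrightarrow> y \<notin> Z \<Longrightarrow> z \<notin> Z \<Longrightarrow> P y \<Longrightarrow> P z"
  shows "P y"
proof -
  interpret H: sym_digraph "with_proj G \<restriction> (pverts G - Z)" by (rule sym_digraph_avoiding)
  show ?thesis
    using assms(1) unfolding reachable_avoiding_def
    by (induction rule: H.reachable_induct) (use assms(2,3) in \<open>auto simp: reachable_avoiding_def\<close>)
qed

lemma reachable_avoiding_if_component_disjoint:
  assumes "reachable_avoiding G Z x y" "\<And>t. t \<in> Z' \<Longrightarrow> \<not> reachable_avoiding G Z x t"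
  shows "reachable_avoiding G Z' x y"
  using assms(1)
proof (induction rule: reachable_avoiding_induct)
  case base
  then show ?case using assms(2)[of x] by auto
next
  case (step y z)
  have "reachable_avoiding G Z x z"
    using step.hyps(1,2,4) by (rule reachable_avoiding_step)
  then show ?case using step assms(2)[of z] reachable_avoiding_step by blast
qed

lemma reachable_avoiding_antimono:
  "reachable_avoiding G Z x y \<Longrightarrow> Z' \<subseteq> Z \<Longrightarrow> reachable_avoiding G Z' x y"
  using reachable_avoiding_if_component_disjoint reachable_avoiding_in_pverts(2) by blast

lemma separator_iff:
  "separator G u v S \<longleftrightarrow> u \<in> pverts G - S \<and> v \<in> pverts G - S \<and> S \<subseteq> pverts G \<and>
    \<not> reachable_avoiding G S u v"
proof -
  define H where "H = with_proj G \<restriction> (pverts G - S)"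
  interpret H: sym_digraph H unfolding H_def by (rule sym_digraph_avoiding)
  have "(\<exists>C\<in>H.sccs_verts. \<exists>D\<in>H.sccs_verts. u \<in> C \<and> v \<in> D \<and> C \<noteq> D) \<longleftrightarrow>
      \<not> reachable_avoiding G S u v"
    if uv: "u \<in> verts H" "v \<in> verts H"
  proof -
    have "C \<in> H.sccs_verts \<and> x \<in> C \<longleftrightarrow> C = H.scc_of x" if "x \<in> verts H" for C x
      using that H.scc_of_in_sccs_verts H.in_scc_of_self H.scc_of_eq
      unfolding H.sccs_verts_conv_scc_of by blast
    with uv have "(\<exists>C\<in>H.sccs_verts. \<exists>D\<in>H.sccs_verts. u \<in> C \<and> v \<in> D \<and> C \<noteq> D) \<longleftrightarrow>
        H.scc_of u \<noteq> H.scc_of v"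
      by metis
    also have "\<dots> \<longleftrightarrow> \<not> u \<rightarrow>\<^sup>*\<^bsub>H\<^esub> v"
      using uv H.scc_ofI_reachable H.scc_of_eq H.in_scc_of_self H.scc_of_def
      by (metis mem_Collect_eq)
    finally show ?thesis
      by (simp add: reachable_avoiding_def H_def)
  qed
  moreover have "u \<noteq> v \<and> (u, v) \<notin> parcs G"
    if "u \<in> verts H" "v \<in> verts H" "\<not> reachable_avoiding G S u v"
    using that reachable_avoiding_arc by (auto simp: H_def)
  ultimately show ?thesis
    unfolding separator_def H_def[symmetric] by (auto simp: H_def)
qed

lemma separator_commute: "separator G u v S \<longleftrightarrow> separator G v u S"
  unfolding separator_iff using reachable_avoiding_sym by blast

lemma minimal_separator_between_commute:
  "minimal_separator_between G u v S \<longleftrightarrow> minimal_separator_between G v u S"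
  by (simp add: minimal_separator_between_def separator_commute[of u v])

lemma separator_finite: "separator G u v S \<Longrightarrow> finite S"
  using finite_subset[OF _ pair_finite_verts, of S] by (simp add: separator_iff)

lemma minimal_separator_between_subset:
  assumes "separator G u v Z"
  obtains S where "S \<subseteq> Z" "minimal_separator_between G u v S"
proof -
  let ?seps = "{S. S \<subseteq> Z \<and> separator G u v S}"
  have "finite ?seps" "?seps \<noteq> {}"
    using assms separator_finite[OF assms] by auto
  from finite_has_minimal[OF this] obtain S where "S \<in> ?seps" "\<forall>S'\<in>?seps. S' \<le> S \<longrightarrow> S = S'"
    by (rule bexE)
  then have "S \<subseteq> Z" "minimal_separator_between G u v S"
    unfolding minimal_separator_between_def by blast+
  then show ?thesis by (rule that)
qed

lemma card_minimal_separator_le: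
  assumes "minimal_separator G S"
  shows "card S \<le> max_minimal_separator_size G"
proof -
  have "card S \<le> card (pverts G)" if "minimal_separator G S" for S
  proof -
    have "S \<subseteq> pverts G"
      using that by (auto simp: minimal_separator_def minimal_separator_between_def separator_iff)
    then show ?thesis
      using pair_finite_verts by (rule card_mono[rotated])
  qed
  then have "\<forall>S. minimal_separator G S \<longrightarrow> card S \<le> max_minimal_separator_size G"
    unfolding max_minimal_separator_size_def
    by (intro LeastI[of "\<lambda>k. \<forall>S. minimal_separator G S \<longrightarrow> card S \<le> k"]) blast
  with assms show ?thesis by blast
qed

lemma minimal_separator_between_adjacent:
  assumes ms: "minimal_separator_between G u v S" and s: "s \<in> S"
  obtains c where "reachable_avoiding G S u c" "(c, s) \<in> parcs G"
proof -
  have sep: "separator G u v S" and "\<not> separator G u v (S - {s})"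
    using ms s unfolding minimal_separator_between_def by blast+
  then have "reachable_avoiding G (S - {s}) u v"
    unfolding separator_iff by blast
  then have "reachable_avoiding G S u v \<or> (\<exists>c. reachable_avoiding G S u c \<and> (c, s) \<in> parcs G)"
  proof (induction rule: reachable_avoiding_induct)
    case base
    then show ?case using sep by (simp add: separator_iff)
  next
    case (step y z)
    then show ?case by (cases "z = s") (auto intro: reachable_avoiding_step)
  qed
  then show ?thesis
    using sep that unfolding separator_iff by blast
qed

end

section \<open>Torsos\<close>

definition attachments :: "'a pair_pre_digraph \<Rightarrow> 'a set \<Rightarrow> 'a \<Rightarrow> 'a set" where
  "attachments G A s = {a \<in> A. \<exists>c. reachable_avoiding G A s c \<and> (c, a) \<in> parcs G}"

definition torso_adj :: "'a pair_pre_digraph \<Rightarrow> 'a set \<Rightarrow> 'a \<Rightarrow> 'a \<Rightarrow> bool" where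
  "torso_adj G A x y \<longleftrightarrow> (x, y) \<in> parcs G \<or> (\<exists>s. x \<in> attachments G A s \<and> y \<in> attachments G A s)"

definition torso_clique :: "'a pair_pre_digraph \<Rightarrow> 'a set \<Rightarrow> 'a set \<Rightarrow> bool" where
  "torso_clique G A Q \<longleftrightarrow> Q \<subseteq> A \<and> (\<forall>x\<in>Q. \<forall>y\<in>Q. x \<noteq> y \<longrightarrow> torso_adj G A x y)"

lemma attachments_subset: "attachments G A s \<subseteq> A"
  by (auto simp: attachments_def)

lemma attachmentsI:
  "a \<in> A \<Longrightarrow> reachable_avoiding G A s c \<Longrightarrow> (c, a) \<in> parcs G \<Longrightarrow> a \<in> attachments G A s"
  by (auto simp: attachments_def)

lemma attachmentsE:
  assumes "a \<in> attachments G A s"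
  obtains c where "a \<in> A" "reachable_avoiding G A s c" "(c, a) \<in> parcs G"
  using assms by (auto simp: attachments_def)

lemma torso_clique_attachments: "Q \<subseteq> attachments G A s \<Longrightarrow> torso_clique G A Q"
  using attachments_subset[of G A s] unfolding torso_clique_def torso_adj_def by (meson subset_iff)

context pair_graph
begin

lemma attachments_cong:
  "reachable_avoiding G A s t \<Longrightarrow> attachments G A s = attachments G A t"
  unfolding attachments_def using reachable_avoiding_sym reachable_avoiding_trans by blast

lemma attachments_outside: "a \<in> attachments G A s \<Longrightarrow> s \<in> pverts G - A"
  by (elim attachmentsE) (rule reachable_avoiding_in_pverts)

lemma attachments_of_neighbour:
  assumes "a \<in> A" "(a, s) \<in> parcs G" "s \<notin> A"
  shows "a \<in> attachments G A s"
proof (rule attachmentsI)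
  show "(s, a) \<in> parcs G"
    using assms(2) by (rule arcs_symmetric)
  then show "reachable_avoiding G A s s"
    using assms(3) in_arcsD1 by simp
qed fact

lemma attachments_reachable_avoiding:
  assumes "a \<in> attachments G A s" "a \<notin> S" "\<And>t. t \<in> S \<Longrightarrow> \<not> reachable_avoiding G A s t"
  shows "reachable_avoiding G S s a"
  using assms
  by (elim attachmentsE) (metis reachable_avoiding_if_component_disjoint reachable_avoiding_step)

lemma attachments_mono:
  assumes "A' \<subseteq> A" "a \<in> A'" "a \<in> attachments G A s"
  shows "a \<in> attachments G A' s"
  using assms reachable_avoiding_antimono unfolding attachments_def by blast

lemma torso_clique_mono:
  assumes "torso_clique G A Q" "A' \<subseteq> A" "Q \<subseteq> A'"
  shows "torso_clique G A' Q"
  using assms attachments_mono[OF assms(2)] unfolding torso_clique_def torso_adj_def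
  by (meson subset_iff)

lemma attachments_step:
  assumes "u \<in> A" "x = u \<or> u \<in> attachments G A x" "(x, y) \<in> parcs G" "y \<notin> A"
  shows "u \<in> attachments G A y"
  using assms(2)
proof
  assume "x = u"
  then show ?thesis
    using assms attachments_of_neighbour by simp
next
  assume attached: "u \<in> attachments G A x"
  then have "reachable_avoiding G A x y"
    using attachments_outside assms(3,4) by (intro reachable_avoiding_arc) auto
  then show ?thesis
    using attached attachments_cong by simp
qed

lemma torso_adj_step:
  assumes "u \<in> A" "x = u \<or> u \<in> attachments G A x" "(x, y) \<in> parcs G" "y \<in> A"
  shows "torso_adj G A u y"
  using assms(2)
proof
  assume "x = u"
  then show ?thesis
    using assms(3) by (simp add: torso_adj_def)
next
  assume attached: "u \<in> attachments G A x"
  then have "y \<in> attachments G A x"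
    using attachments_outside assms(3,4) arcs_symmetric by (intro attachments_of_neighbour) auto
  then show ?thesis
    using attached unfolding torso_adj_def by blast
qed

lemma separator_of_not_torso_adj:
  assumes A: "A \<subseteq> pverts G" and uv: "u \<in> A" "v \<in> A" "u \<noteq> v" and nadj: "\<not> torso_adj G A u v"
  shows "separator G u v (A - {u, v})"
proof -
  have "x = u \<or> u \<in> attachments G A x" if "reachable_avoiding G (A - {u, v}) u x" for x
    using that
  proof (induction rule: reachable_avoiding_induct)
    case base
    then show ?case by simp
  next
    case (step x y)
    show ?case
    proof (cases "y \<in> A")
      case True
      then have "y \<noteq> v"
        using torso_adj_step[OF uv(1) step.IH] step.hyps(2) nadj by blast
      then show ?thesis
        using True step.hyps(4) by simp
    next
      case False
      then show ?thesis
        using attachments_step[OF uv(1) step.IH step.hyps(2)] by simp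
    qed
  qed
  then have "\<not> reachable_avoiding G (A - {u, v}) u v"
    using uv attachments_outside by blast
  then show ?thesis
    using A uv by (auto simp: separator_iff)
qed

end

section \<open>Decomposing along minimal separators\<close>

definition separation :: "'a pair_pre_digraph \<Rightarrow> 'a set \<Rightarrow> 'a set \<Rightarrow> bool" where
  "separation G A B \<longleftrightarrow> (\<forall>x\<in>A - B. \<forall>y\<in>B - A. \<not> reachable_avoiding G (A \<inter> B) x y)"

definition torso_split :: "'a pair_pre_digraph \<Rightarrow> 'a set \<Rightarrow> 'a set \<Rightarrow> 'a set \<Rightarrow> bool" where
  "torso_split G A B C \<longleftrightarrow> B \<subset> A \<and> C \<subset> A \<and> B \<union> C = A \<and> separation G B C \<and>
     minimal_separator G (B \<inter> C) \<and> torso_clique G B (B \<inter> C) \<and> torso_clique G C (B \<inter> C)"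

definition attached_to_separators :: "'a pair_pre_digraph \<Rightarrow> 'a set \<Rightarrow> bool" where
  "attached_to_separators G A \<longleftrightarrow>
     (\<forall>s\<in>pverts G - A. \<exists>S. minimal_separator G S \<and> attachments G A s \<subseteq> S)"

definition complete_torso_decomposition :: "'a pair_pre_digraph \<Rightarrow> 'a set \<Rightarrow> 'a set list \<Rightarrow> bool" where
  "complete_torso_decomposition G A Bs \<longleftrightarrow> running_intersection Bs \<and> \<Union>(set Bs) = A \<and>
     (\<forall>Q. torso_clique G A Q \<longrightarrow> (\<exists>B\<in>set Bs. Q \<subseteq> B)) \<and>
     (\<forall>B\<in>set Bs. torso_clique G B B \<and> attached_to_separators G B)"

context pair_graph
begin

lemma separation_commute: "separation G A B \<longleftrightarrow> separation G B A"
  unfolding separation_def using reachable_avoiding_sym by (metis Int_commute)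

lemma torso_split_commute: "torso_split G A B C \<longleftrightarrow> torso_split G A C B"
  by (auto simp: torso_split_def separation_commute[of B C] Int_commute Un_commute)

lemma separation_not_torso_adj:
  assumes sep: "separation G A B" and xy: "x \<in> A - B" "y \<in> B - A"
  shows "\<not> torso_adj G (A \<union> B) x y"
proof
  assume "torso_adj G (A \<union> B) x y"
  then consider (arc) "(x, y) \<in> parcs G"
    | (attached) s where "x \<in> attachments G (A \<union> B) s" "y \<in> attachments G (A \<union> B) s"
    by (auto simp: torso_adj_def)
  then have "reachable_avoiding G (A \<inter> B) x y"
  proof cases
    case arc
    then show ?thesis using xy by (intro reachable_avoiding_arc) auto
  next
    case attached
    have "reachable_avoiding G (A \<inter> B) s a"
      if "a \<in> attachments G (A \<union> B) s" "a \<notin> A \<inter> B" for a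
      using that reachable_avoiding_in_pverts(2)
      by (intro attachments_reachable_avoiding[of a "A \<union> B"]) blast+
    then show ?thesis
      using attached xy reachable_avoiding_sym reachable_avoiding_trans by (metis DiffD2 IntE)
  qed
  then show False
    using sep xy by (simp add: separation_def)
qed

lemma torso_clique_separation:
  assumes sep: "separation G A B" and Q: "torso_clique G (A \<union> B) Q"
  shows "Q \<subseteq> A \<or> Q \<subseteq> B"
proof (rule ccontr)
  assume "\<not> (Q \<subseteq> A \<or> Q \<subseteq> B)"
  then obtain x y where xy: "x \<in> Q" "x \<notin> B" "y \<in> Q" "y \<notin> A" by blast
  moreover have "x \<in> A" "y \<in> B"
    using xy Q by (auto simp: torso_clique_def)
  ultimately have "\<not> torso_adj G (A \<union> B) x y" "x \<noteq> y"
    using separation_not_torso_adj[OF sep] by auto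
  then show False
    using xy Q by (auto simp: torso_clique_def)
qed

lemma attachments_separation:
  assumes sep: "separation G A B"
  shows "attachments G A s \<subseteq> A \<inter> B \<or> s \<notin> B \<and> attachments G A s \<subseteq> attachments G (A \<union> B) s"
proof (cases "\<exists>b\<in>B. reachable_avoiding G A s b")
  case True
  then obtain b where b: "b \<in> B" "reachable_avoiding G A s b" by blast
  then have "b \<notin> A"
    using reachable_avoiding_in_pverts(2) by blast
  have "a \<in> B" if a: "a \<in> attachments G A s" for a
  proof (rule ccontr)
    assume "a \<notin> B"
    then have "reachable_avoiding G (A \<inter> B) s a"
      using a reachable_avoiding_in_pverts(2)
      by (intro attachments_reachable_avoiding[of a A]) blast+
    moreover have "reachable_avoiding G (A \<inter> B) s b"
      using b(2) by (rule reachable_avoiding_antimono) blast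
    ultimately have "reachable_avoiding G (A \<inter> B) a b"
      using reachable_avoiding_sym reachable_avoiding_trans by blast
    moreover have "a \<in> A - B" "b \<in> B - A"
      using a attachments_subset[of G A s] \<open>a \<notin> B\<close> \<open>b \<in> B\<close> \<open>b \<notin> A\<close> by auto
    ultimately show False
      using sep by (simp add: separation_def)
  qed
  then show ?thesis
    using attachments_subset[of G A s] by auto
next
  case False
  have "reachable_avoiding G (A \<union> B) s c" if "reachable_avoiding G A s c" for c
    using that
    by (rule reachable_avoiding_if_component_disjoint)
      (use False reachable_avoiding_in_pverts(2)[of A s] in auto)
  then have sub: "attachments G A s \<subseteq> attachments G (A \<union> B) s"
    unfolding attachments_def by blast
  show ?thesis
  proof (cases "attachments G A s = {}")
    case True
    then show ?thesis by simp
  next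
    case False
    then have "s \<in> pverts G - (A \<union> B)"
      using sub attachments_outside by blast
    then show ?thesis using sub by simp
  qed
qed

lemma attached_to_separators_split:
  assumes split: "torso_split G A B C" and A: "attached_to_separators G A"
  shows "attached_to_separators G B"
  unfolding attached_to_separators_def
proof
  fix s assume s: "s \<in> pverts G - B"
  have BC: "separation G B C" "minimal_separator G (B \<inter> C)" "B \<union> C = A"
    using split by (simp_all add: torso_split_def)
  consider "attachments G B s \<subseteq> B \<inter> C"
    | (outside) "s \<notin> C" "attachments G B s \<subseteq> attachments G A s"
    using attachments_separation[OF BC(1), of s] BC(3) by auto
  then show "\<exists>S. minimal_separator G S \<and> attachments G B s \<subseteq> S"
  proof cases
    case outside
    then have "s \<in> pverts G - A"
      using s BC(3) by auto
    then show ?thesis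
      using A outside(2) unfolding attached_to_separators_def by (meson subset_trans)
  qed (use BC(2) in blast)
qed

lemma torso_clique_minimal_separator:
  assumes sep: "separation G A B" and ms: "minimal_separator_between G v u (A \<inter> B)"
    and v: "v \<in> B - A"
  shows "torso_clique G A (A \<inter> B)"
proof (rule torso_clique_attachments)
  show "A \<inter> B \<subseteq> attachments G A v"
  proof
    fix s assume s: "s \<in> A \<inter> B"
    then obtain c where c: "reachable_avoiding G (A \<inter> B) v c" "(c, s) \<in> parcs G"
      using minimal_separator_between_adjacent[OF ms] by blast
    have "\<not> reachable_avoiding G (A \<inter> B) v t" if "t \<in> A" for t
    proof
      assume vt: "reachable_avoiding G (A \<inter> B) v t"
      then have "t \<in> A - B"
        using that reachable_avoiding_in_pverts(2) by blast
      then show False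
        using sep v reachable_avoiding_sym[OF vt] by (simp add: separation_def)
    qed
    then have "reachable_avoiding G A v c"
      using reachable_avoiding_if_component_disjoint[OF c(1)] by blast
    then show "s \<in> attachments G A v"
      using s c(2) by (intro attachmentsI) auto
  qed
qed

lemma torso_split_exists:
  assumes A: "A \<subseteq> pverts G" and nc: "\<not> torso_clique G A A"
  obtains B C where "torso_split G A B C"
proof -
  obtain u v where uv: "u \<in> A" "v \<in> A" "u \<noteq> v" "\<not> torso_adj G A u v"
    using nc by (auto simp: torso_clique_def)
  obtain S where SA: "S \<subseteq> A - {u, v}" and ms: "minimal_separator_between G u v S"
    using minimal_separator_between_subset[OF separator_of_not_torso_adj[OF A uv]] .
  have uvS: "u \<in> pverts G - S" "v \<in> pverts G - S" "\<not> reachable_avoiding G S u v"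
    using ms by (auto simp: minimal_separator_between_def separator_iff)
  define D where "D = {a \<in> A. reachable_avoiding G S u a}"
  define B where "B = D \<union> S"
  define C where "C = A - D"
  have D: "D \<subseteq> A" "u \<in> D" "v \<notin> D" "D \<inter> S = {}"
    using uv uvS reachable_avoiding_in_pverts(2) by (auto simp: D_def)
  have BC: "B \<inter> C = S" "B \<union> C = A" "B \<subset> A" "C \<subset> A"
    using D uv SA by (auto simp: B_def C_def)
  have sep: "separation G B C"
    unfolding separation_def
  proof (intro ballI notI)
    fix x y assume "x \<in> B - C" "y \<in> C - B" and xy: "reachable_avoiding G (B \<inter> C) x y"
    then have "reachable_avoiding G S u x" "y \<in> A" "y \<notin> D"
      using BC by (auto simp: B_def C_def D_def)
    then show False
      using xy BC(1) reachable_avoiding_trans[of S u x y] by (simp add: D_def)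
  qed
  have "torso_clique G B S"
    using torso_clique_minimal_separator[OF sep, of v u] ms D uv SA BC
      minimal_separator_between_commute by (auto simp: B_def C_def)
  moreover have "torso_clique G C S"
    using torso_clique_minimal_separator[of C B u v] sep ms D uv SA BC
      separation_commute by (auto simp: B_def C_def Int_commute)
  moreover have "minimal_separator G S"
    using ms by (auto simp: minimal_separator_def)
  ultimately have "torso_split G A B C"
    using sep BC by (simp add: torso_split_def)
  then show ?thesis by (rule that)
qed

lemma torso_split_obtain_superset:
  assumes A: "A \<subseteq> pverts G" "\<not> torso_clique G A A" and Q: "torso_clique G A Q"
  obtains B C where "torso_split G A B C" "Q \<subseteq> B"
proof -
  obtain B C where split: "torso_split G A B C"
    using torso_split_exists[OF A] .
  then have "Q \<subseteq> B \<or> Q \<subseteq> C"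
    using torso_clique_separation[of B C Q] Q by (auto simp: torso_split_def)
  then show ?thesis
    using that split torso_split_commute by blast
qed

lemma complete_torso_decomposition_singleton:
  assumes "torso_clique G A A" "attached_to_separators G A"
  shows "complete_torso_decomposition G A [A]"
  using assms unfolding complete_torso_decomposition_def
  by (auto simp: torso_clique_def intro: running_intersection.singleton)

lemma complete_torso_decomposition_append:
  assumes split: "torso_split G A B C"
    and Bs: "complete_torso_decomposition G B Bs" and Cs: "complete_torso_decomposition G C Cs"
    and hd: "B \<inter> C \<subseteq> hd Cs"
  shows "complete_torso_decomposition G A (Bs @ Cs)"
proof -
  have BC: "B \<union> C = A" and sep: "separation G B C" and clique: "torso_clique G B (B \<inter> C)"
    using split by (auto simp: torso_split_def)
  obtain X where X: "X \<in> set Bs" "B \<inter> C \<subseteq> X"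
    using Bs clique unfolding complete_torso_decomposition_def by blast
  have "running_intersection (Bs @ Cs)"
    using Bs Cs X hd running_intersection_append[of Bs X Cs]
    by (simp add: complete_torso_decomposition_def)
  moreover have "\<exists>X\<in>set (Bs @ Cs). Q \<subseteq> X" if Q: "torso_clique G A Q" for Q
  proof -
    have "Q \<subseteq> B \<or> Q \<subseteq> C"
      using torso_clique_separation[OF sep] Q BC by simp
    then have "torso_clique G B Q \<or> torso_clique G C Q"
      using torso_clique_mono[OF Q] BC by blast
    then have "(\<exists>X\<in>set Bs. Q \<subseteq> X) \<or> (\<exists>X\<in>set Cs. Q \<subseteq> X)"
      using Bs Cs unfolding complete_torso_decomposition_def by blast
    then show ?thesis by auto
  qed
  ultimately show ?thesis
    using Bs Cs BC unfolding complete_torso_decomposition_def by auto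
qed

text \<open>Prescribing a clique in the first bag is what allows the decompositions of the two sides of
  a separator to be joined.\<close>

lemma complete_torso_decomposition_exists:
  assumes "A \<subseteq> pverts G" "attached_to_separators G A" "torso_clique G A Q"
  shows "\<exists>Bs. complete_torso_decomposition G A Bs \<and> Q \<subseteq> hd Bs"
  using assms
proof (induction "card A" arbitrary: A Q rule: less_induct)
  case less
  show ?case
  proof (cases "torso_clique G A A")
    case True
    then show ?thesis
      using less.prems complete_torso_decomposition_singleton
      by (intro exI[of _ "[A]"]) (simp add: torso_clique_def)
  next
    case False
    obtain B C where split: "torso_split G A B C" and QB: "Q \<subseteq> B"
      using torso_split_obtain_superset[OF less.prems(1) False less.prems(3)] .
    then have BC: "B \<subset> A" "C \<subset> A" and clique: "torso_clique G C (B \<inter> C)"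
      by (auto simp: torso_split_def)
    have V: "B \<subseteq> pverts G" "C \<subseteq> pverts G" and smaller: "card B < card A" "card C < card A"
      using BC less.prems(1) finite_subset[OF _ pair_finite_verts]
      by (auto intro: psubset_card_mono)
    have att: "attached_to_separators G B" "attached_to_separators G C"
      using attached_to_separators_split less.prems(2) split torso_split_commute by blast+
    have Q: "torso_clique G B Q"
      using torso_clique_mono less.prems(3) QB BC by blast
    obtain Bs where Bs: "complete_torso_decomposition G B Bs" "Q \<subseteq> hd Bs"
      using less.hyps[OF smaller(1) V(1) att(1) Q] by blast
    obtain Cs where Cs: "complete_torso_decomposition G C Cs" "B \<inter> C \<subseteq> hd Cs"
      using less.hyps[OF smaller(2) V(2) att(2) clique] by blast
    have "Bs \<noteq> []"
      using Bs(1) running_intersection_nonempty by (auto simp: complete_torso_decomposition_def)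
    then show ?thesis
      using complete_torso_decomposition_append[OF split Bs(1) Cs] Bs(2)
      by (intro exI[of _ "Bs @ Cs"]) simp
  qed
qed

lemma separator_component_attached:
  assumes compl: "torso_clique G A A" and xy: "x \<in> A - S" "y \<in> A - S" "(x, y) \<notin> parcs G"
    and sep: "x \<noteq> y" "\<not> reachable_avoiding G S x y"
  obtains s where "s \<in> S" "x \<in> attachments G A s"
proof -
  obtain s where s: "x \<in> attachments G A s" "y \<in> attachments G A s"
    using compl xy sep(1) by (auto simp: torso_clique_def torso_adj_def)
  have "\<exists>t\<in>S. reachable_avoiding G A s t"
  proof (rule ccontr)
    assume "\<not> (\<exists>t\<in>S. reachable_avoiding G A s t)"
    then have "reachable_avoiding G S s x" "reachable_avoiding G S s y"
      using attachments_reachable_avoiding s xy by blast+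
    then show False
      using sep reachable_avoiding_sym reachable_avoiding_trans by blast
  qed
  then show ?thesis
    using that s(1) attachments_cong by blast
qed

lemma independent_set_in_complete_torso_subset:
  assumes compl: "torso_clique G A A" and I: "I \<subseteq> A" "independent_set (with_proj G) I"
    and uv: "u \<in> I - S" "v \<in> I - S" and sep: "separator G u v S"
  shows "I \<subseteq> (\<Union>s\<in>S. if s \<in> A then {s} else attachments G A s)"
proof
  fix x assume x: "x \<in> I"
  show "x \<in> (\<Union>s\<in>S. if s \<in> A then {s} else attachments G A s)"
  proof (cases "x \<in> S")
    case True
    then show ?thesis using x I(1) by auto
  next
    case False
    have "\<not> reachable_avoiding G S x u \<or> \<not> reachable_avoiding G S x v"
      using sep reachable_avoiding_sym reachable_avoiding_trans unfolding separator_iff by blast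
    then obtain y where y: "y \<in> I - S" "\<not> reachable_avoiding G S x y"
      using uv by blast
    have "x \<in> pverts G" "(x, y) \<notin> parcs G"
      using I x y(1) by (auto simp: independent_set_def)
    moreover from this have "x \<noteq> y"
      using y(2) False by auto
    ultimately obtain s where "s \<in> S" "x \<in> attachments G A s"
      using separator_component_attached[OF compl, of x S y] x False y I(1) by blast
    moreover from this have "s \<notin> A"
      using attachments_outside by blast
    ultimately show ?thesis by auto
  qed
qed

lemma minimal_separator_finite: "minimal_separator G S \<Longrightarrow> finite S"
  using separator_finite by (auto simp: minimal_separator_def minimal_separator_between_def)

lemma attachments_finite_card_le:
  assumes seps: "\<And>S. minimal_separator G S \<Longrightarrow> card S \<le> k"
    and "attached_to_separators G A" "s \<in> pverts G - A"
  shows "finite (attachments G A s) \<and> card (attachments G A s) \<le> k"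
proof -
  obtain S where S: "minimal_separator G S" "attachments G A s \<subseteq> S"
    using assms unfolding attached_to_separators_def by blast
  then have "card (attachments G A s) \<le> card S"
    using minimal_separator_finite by (intro card_mono)
  then show ?thesis
    using S seps[OF S(1)] minimal_separator_finite[OF S(1)] finite_subset by auto
qed

lemma nonadjacent_minimal_separator:
  assumes uv: "u \<in> pverts G" "v \<in> pverts G" "u \<noteq> v" "(u, v) \<notin> parcs G"
  obtains S where "minimal_separator_between G u v S"
proof -
  have "\<not> torso_adj G (pverts G) u v"
    using uv(4) attachments_outside unfolding torso_adj_def by blast
  then have "separator G u v (pverts G - {u, v})"
    using uv by (intro separator_of_not_torso_adj) simp_all
  then show ?thesis
    using minimal_separator_between_subset that by blast
qed

lemma card_independent_set_in_complete_torso_le: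
  assumes seps: "\<And>S. minimal_separator G S \<Longrightarrow> card S \<le> k"
    and compl: "torso_clique G A A" and att: "attached_to_separators G A"
    and I: "I \<subseteq> A" "independent_set (with_proj G) I"
  shows "card I \<le> max 1 (k\<^sup>2)"
proof (cases "\<exists>u\<in>I. \<exists>v\<in>I. u \<noteq> v")
  case False
  then have "card I \<le> 1"
    by (metis card.infinite card_le_Suc0_iff_eq One_nat_def zero_le)
  then show ?thesis by simp
next
  case True
  then obtain u v where uv: "u \<in> I" "v \<in> I" "u \<noteq> v" by blast
  moreover have "I \<subseteq> pverts G" "(u, v) \<notin> parcs G"
    using I(2) uv by (auto simp: independent_set_def)
  ultimately obtain S where "minimal_separator_between G u v S"
    using nonadjacent_minimal_separator[of u v] by blast
  then have sep: "separator G u v S" and ms: "minimal_separator G S"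
    by (auto simp: minimal_separator_between_def minimal_separator_def)
  let ?N = "\<lambda>s. if s \<in> A then {s} else attachments G A s"
  have S: "finite S" "S \<subseteq> pverts G" "u \<in> I - S" "v \<in> I - S"
    using uv sep minimal_separator_finite[OF ms] by (auto simp: separator_iff)
  have N: "finite (?N s) \<and> card (?N s) \<le> k" if "s \<in> S" for s
  proof (cases "s \<in> A")
    case True
    have "card {s} \<le> card S"
      using that S(1) by (intro card_mono) auto
    with True show ?thesis using seps[OF ms] by simp
  next
    case False
    then show ?thesis
      using attachments_finite_card_le[OF seps att] that S(2) by auto
  qed
  have "card I \<le> card (\<Union>s\<in>S. ?N s)"
    using S N independent_set_in_complete_torso_subset[OF compl I S(3,4) sep]
    by (intro card_mono) blast+
  also have "\<dots> \<le> (\<Sum>s\<in>S. card (?N s))"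
    using S(1) by (rule card_UN_le)
  also have "\<dots> \<le> card S * k"
    using N sum_bounded_above[of S "\<lambda>s. card (?N s)" k] by simp
  also have "\<dots> \<le> k\<^sup>2"
    using seps[OF ms] by (simp add: power2_eq_square)
  finally show ?thesis by simp
qed

lemma tree_independence_number_le_max_minimal_separator_size:
  "tree_independence_number G \<le> max 1 ((max_minimal_separator_size G)\<^sup>2)"
proof -
  have "attached_to_separators G (pverts G)" "torso_clique G (pverts G) {}"
    by (simp_all add: attached_to_separators_def torso_clique_def)
  then obtain Bs where Bs: "complete_torso_decomposition G (pverts G) Bs"
    using complete_torso_decomposition_exists[OF subset_refl, of "{}"] by blast
  then have cliques: "\<exists>B\<in>set Bs. Q \<subseteq> B" if "torso_clique G (pverts G) Q" for Q
    using that unfolding complete_torso_decomposition_def by blast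
  show ?thesis
  proof (rule tree_independence_number_le_running_intersection)
    show "running_intersection Bs" "\<Union>(set Bs) = pverts G"
      using Bs by (simp_all add: complete_torso_decomposition_def)
    show "\<exists>B\<in>set Bs. u \<in> B \<and> v \<in> B" if "(u, v) \<in> parcs G" for u v
    proof -
      have "torso_clique G (pverts G) {u, v}"
        using in_arcsD1[OF that] in_arcsD2[OF that] that arcs_symmetric[OF that]
        by (simp add: torso_clique_def torso_adj_def)
      then show ?thesis using cliques[of "{u, v}"] by simp
    qed
    fix B I assume B: "B \<in> set Bs" and I: "I \<subseteq> B" "independent_set (with_proj G) I"
    have "torso_clique G B B" "attached_to_separators G B"
      using Bs B by (simp_all add: complete_torso_decomposition_def)
    then show "card I \<le> max 1 ((max_minimal_separator_size G)\<^sup>2)"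
      using card_independent_set_in_complete_torso_le[OF card_minimal_separator_le] I by blast
  qed
qed

end

section \<open>Intersection treewidth\<close>

lemma digraph_iso_with_projE:
  assumes "pair_wf_digraph G" and iso: "digraph_iso (with_proj G) (with_proj H)"
  obtains g where "bij_betw g (pverts G) (pverts H)"
    and "\<forall>u\<in>pverts G. \<forall>v\<in>pverts G. (u, v) \<in> parcs G \<longleftrightarrow> (g u, g v) \<in> parcs H"
proof -
  interpret G: pair_wf_digraph G by fact
  obtain f where f: "G.digraph_isomorphism f" and H_eq: "with_proj H = app_iso f (with_proj G)"
    using iso unfolding digraph_iso_def by blast
  have ends: "iso_tail f = fst" "iso_head f = snd"
    and verts: "pverts H = iso_verts f ` pverts G" and arcs: "parcs H = iso_arcs f ` parcs G"
    using H_eq by (auto simp: with_proj_def app_iso_def)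
  have inj: "inj_on (iso_verts f) (pverts G)"
    using G.digraph_isomorphism_inj_on_verts[OF f] .
  have "iso_arcs f e = map_prod (iso_verts f) (iso_verts f) e" if "e \<in> parcs G" for e
    using G.iso_verts_tail[OF f that] G.iso_verts_head[OF f that] ends
    by (cases e) (auto simp: prod_eq_iff)
  then have parcs: "parcs H = map_prod (iso_verts f) (iso_verts f) ` parcs G"
    unfolding arcs by (rule image_cong[OF refl])
  have "(u, v) \<in> parcs G \<longleftrightarrow> (iso_verts f u, iso_verts f v) \<in> parcs H"
    if uv: "u \<in> pverts G" "v \<in> pverts G" for u v
  proof
    assume "(iso_verts f u, iso_verts f v) \<in> parcs H"
    then obtain x y where xy: "(x, y) \<in> parcs G" "iso_verts f u = iso_verts f x"
      "iso_verts f v = iso_verts f y"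
      unfolding parcs by auto
    then have "u = x" "v = y"
      using uv G.wellformed'[OF xy(1)] by (auto intro: inj_onD[OF inj])
    then show "(u, v) \<in> parcs G" using xy(1) by simp
  qed (force simp: parcs)
  with verts inj show ?thesis
    by (intro that[of "iso_verts f"]) (auto simp: bij_betw_def)
qed

lemma digraph_iso_with_projI:
  assumes "pair_wf_digraph G" "pair_wf_digraph H" and g: "bij_betw g (pverts G) (pverts H)"
    and adj: "\<And>u v. u \<in> pverts G \<Longrightarrow> v \<in> pverts G \<Longrightarrow> (u, v) \<in> parcs G \<longleftrightarrow> (g u, g v) \<in> parcs H"
  shows "digraph_iso (with_proj G) (with_proj H)"
proof -
  interpret G: pair_wf_digraph G by fact
  interpret H: pair_wf_digraph H by fact
  let ?f = "\<lparr>iso_verts = g, iso_arcs = map_prod g g, iso_head = snd, iso_tail = fst\<rparr>"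
  have inj: "inj_on g (pverts G)" and img: "pverts H = g ` pverts G"
    using g by (auto simp: bij_betw_def)
  have "parcs G \<subseteq> pverts G \<times> pverts G"
    using G.wellformed' by auto
  then have "inj_on (map_prod g g) (parcs G)"
    using map_prod_inj_on[OF inj inj] inj_on_subset by blast
  then have "G.digraph_isomorphism ?f"
    using inj G.wf_digraph by (simp add: G.digraph_isomorphism_def)
  moreover have "parcs H = map_prod g g ` parcs G"
  proof
    show "map_prod g g ` parcs G \<subseteq> parcs H"
    proof
      fix e assume "e \<in> map_prod g g ` parcs G"
      then obtain u v where uv: "e = (g u, g v)" "(u, v) \<in> parcs G"
        by auto
      then show "e \<in> parcs H"
        using adj[of u v] G.wellformed'[OF uv(2)] by simp
    qed
    show "parcs H \<subseteq> map_prod g g ` parcs G"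
    proof
      fix e assume e: "e \<in> parcs H"
      then have "fst e \<in> g ` pverts G" "snd e \<in> g ` pverts G"
        using H.arc_fst_in_verts H.arc_snd_in_verts img by auto
      then obtain u v where uv: "e = (g u, g v)" "u \<in> pverts G" "v \<in> pverts G"
        by (metis imageE prod.collapse)
      then have "(u, v) \<in> parcs G"
        using adj[OF uv(2,3)] e by simp
      then show "e \<in> map_prod g g ` parcs G"
        using uv(1) by force
    qed
  qed
  then have "with_proj H = app_iso ?f (with_proj G)"
    using img by (simp add: with_proj_def app_iso_def)
  ultimately show ?thesis
    unfolding digraph_iso_def by blast
qed

definition intersection_model ::
  "'a pair_pre_digraph \<Rightarrow> 'h pair_pre_digraph \<Rightarrow> ('a \<Rightarrow> 'h pair_pre_digraph) \<Rightarrow> bool" where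
  "intersection_model G H K \<longleftrightarrow> (\<forall>v\<in>pverts G. connected_subgraph (K v) H) \<and>
     (\<forall>u\<in>pverts G. \<forall>v\<in>pverts G. u \<noteq> v \<longrightarrow>
        ((u, v) \<in> parcs G \<longleftrightarrow> pverts (K u) \<inter> pverts (K v) \<noteq> {}))"

definition complete_on :: "'h set \<Rightarrow> 'h pair_pre_digraph" where
  "complete_on W = \<lparr>pverts = W, parcs = {(x, y). x \<in> W \<and> y \<in> W \<and> x \<noteq> y}\<rparr>"

lemma complete_on_simps [simp]:
  "pverts (complete_on W) = W"
  "parcs (complete_on W) = {(x, y). x \<in> W \<and> y \<in> W \<and> x \<noteq> y}"
  by (simp_all add: complete_on_def)

lemma pair_graph_complete_on: "finite W \<Longrightarrow> pair_graph (complete_on W)"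
  by (intro pair_graphI) (auto simp: sym_def irrefl_def)

lemma connected_subgraph_complete_on:
  assumes "finite W" "W' \<subseteq> W" "W' \<noteq> {}"
  shows "connected_subgraph (complete_on W') (complete_on W)"
proof -
  interpret W: pair_graph "complete_on W"
    using assms by (intro pair_graph_complete_on)
  interpret W': pair_graph "complete_on W'"
    using assms finite_subset by (intro pair_graph_complete_on) blast
  obtain r where "r \<in> W'" using assms(3) by blast
  moreover from this have "r \<rightarrow>\<^sup>*\<^bsub>with_proj (complete_on W')\<^esub> x" if "x \<in> W'" for x
    using that by (cases "x = r") auto
  ultimately have "connected (with_proj (complete_on W'))"
    using W'.connected_iff_reachable_from[of r] by simp
  moreover have "subgraph (with_proj (complete_on W')) (with_proj (complete_on W))"
    using assms W'.wf_digraph W.wf_digraph by (intro subgraphI) auto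
  ultimately show ?thesis
    using W'.pair_graph by (simp add: connected_subgraph_def)
qed

context pair_graph
begin

lemma representable_in_imp_intersection_model:
  assumes "representable_in G H"
  obtains K where "intersection_model G H K"
proof -
  obtain p Hs where Hs: "\<forall>i\<in>{1..p}. connected_subgraph (Hs i) H"
    and iso: "digraph_iso (with_proj G) (with_proj (intersection_graph p Hs))"
    using assms unfolding representable_in_def by blast
  obtain g where g: "bij_betw g (pverts G) (pverts (intersection_graph p Hs))"
    and adj: "\<forall>u\<in>pverts G. \<forall>v\<in>pverts G.
      (u, v) \<in> parcs G \<longleftrightarrow> (g u, g v) \<in> parcs (intersection_graph p Hs)"
    using digraph_iso_with_projE[OF pair_wf_digraph iso] .
  have range: "g v \<in> {1..p}" if "v \<in> pverts G" for v
    using bij_betwE[OF g] that by (simp add: intersection_graph_def)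
  have "g u \<noteq> g v" if "u \<in> pverts G" "v \<in> pverts G" "u \<noteq> v" for u v
    using that bij_betw_imp_inj_on[OF g] by (auto dest: inj_onD)
  then have "intersection_model G H (\<lambda>v. Hs (g v))"
    using Hs adj range by (simp add: intersection_model_def intersection_graph_def)
  then show ?thesis by (rule that)
qed

lemma intersection_model_imp_representable_in:
  assumes model: "intersection_model G H K"
  shows "representable_in G H"
proof -
  define p where "p = card (pverts G)"
  obtain h where h: "bij_betw h {1..p} (pverts G)"
    using ex_bij_betw_nat_finite_1[OF pair_finite_verts] unfolding p_def by blast
  define g where "g = inv_into {1..p} h"
  let ?I = "intersection_graph p (\<lambda>i. K (h i))"
  have g: "bij_betw g (pverts G) {1..p}"
    unfolding g_def using h by (rule bij_betw_inv_into)
  have hg: "h (g v) = v" if "v \<in> pverts G" for v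
    unfolding g_def using h that by (rule bij_betw_inv_into_right)
  have "digraph_iso (with_proj G) (with_proj ?I)"
  proof (rule digraph_iso_with_projI[OF pair_wf_digraph])
    show "pair_wf_digraph ?I"
      by unfold_locales (auto simp: intersection_graph_def)
    show "bij_betw g (pverts G) (pverts ?I)"
      using g by (simp add: intersection_graph_def)
    fix u v assume uv: "u \<in> pverts G" "v \<in> pverts G"
    have "g u \<in> {1..p}" "g v \<in> {1..p}" "g u = g v \<longleftrightarrow> u = v"
      using uv bij_betwE[OF g] inj_on_eq_iff[OF bij_betw_imp_inj_on[OF g]] by auto
    then show "(u, v) \<in> parcs G \<longleftrightarrow> (g u, g v) \<in> parcs ?I"
      using uv model hg no_loops'[of u v]
      by (cases "u = v") (auto simp: intersection_model_def intersection_graph_def)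
  qed
  moreover have "\<forall>i\<in>{1..p}. connected_subgraph (K (h i)) H"
    using model bij_betwE[OF h] by (simp add: intersection_model_def)
  ultimately show ?thesis
    unfolding representable_in_def by (intro exI[of _ p] exI[of _ "\<lambda>i. K (h i)"] conjI)
qed

text \<open>The stars of distinct vertices \<open>u\<close> and \<open>v\<close> can only share the set \<open>{u, v}\<close>, which belongs to
  them if and only if \<open>u\<close> and \<open>v\<close> are adjacent.\<close>

lemma intersection_model_exists:
  obtains H :: "nat pair_pre_digraph" and K where "pair_graph H" "intersection_model G H K"
proof -
  obtain code :: "'a set \<Rightarrow> nat" where code: "inj_on code (Pow (pverts G))"
    using finite_imp_inj_to_nat_seg[of "Pow (pverts G)"] pair_finite_verts by auto
  define star where "star v = {{v, w} |w. w \<in> pverts G \<and> (w = v \<or> (v, w) \<in> parcs G)}" for v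
  define W where "W = code ` Pow (pverts G)"
  have W: "finite W"
    using pair_finite_verts by (simp add: W_def)
  have star: "star v \<subseteq> Pow (pverts G)" "{v} \<in> star v" if "v \<in> pverts G" for v
    using that by (auto simp: star_def)
  have "connected_subgraph (complete_on (code ` star v)) (complete_on W)" if "v \<in> pverts G" for v
    using star[OF that] W by (intro connected_subgraph_complete_on) (auto simp: W_def)
  moreover have "(u, v) \<in> parcs G \<longleftrightarrow> code ` star u \<inter> code ` star v \<noteq> {}"
    if uv: "u \<in> pverts G" "v \<in> pverts G" "u \<noteq> v" for u v
  proof -
    have "code ` star u \<inter> code ` star v = code ` (star u \<inter> star v)"
      using inj_on_image_Int[OF code] star uv by simp
    moreover have "star u \<inter> star v \<noteq> {} \<longleftrightarrow> (u, v) \<in> parcs G"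
      using uv arcs_symmetric by (auto simp: star_def doubleton_eq_iff)
    ultimately show ?thesis by auto
  qed
  ultimately have "intersection_model G (complete_on W) (\<lambda>v. complete_on (code ` star v))"
    by (simp add: intersection_model_def)
  with pair_graph_complete_on[OF W] show ?thesis by (rule that)
qed

lemma intersection_treewidth_attained:
  obtains H :: "nat pair_pre_digraph" and K
  where "pair_graph H" "treewidth H \<le> int (intersection_treewidth G)" "intersection_model G H K"
proof -
  let ?P = "\<lambda>k. \<exists>H :: nat pair_pre_digraph.
    pair_graph H \<and> treewidth H \<le> int k \<and> representable_in G H"
  obtain H :: "nat pair_pre_digraph" and K where "pair_graph H" "intersection_model G H K"
    using intersection_model_exists .
  then have "?P (nat (treewidth H))"
    using intersection_model_imp_representable_in by (intro exI[of _ H]) simp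
  then have "?P (intersection_treewidth G)"
    unfolding intersection_treewidth_def by (rule LeastI)
  then show ?thesis
    using that representable_in_imp_intersection_model by metis
qed

end

lemma connected_nodes_meeting_connected_subgraph:
  assumes td: "tree_decomposition H T X" and K: "connected_subgraph K H"
  shows "connected (with_proj T \<restriction> {t \<in> pverts T. pverts K \<inter> X t \<noteq> {}})"
proof -
  interpret T: pair_graph T
    using td by (simp add: tree_decomposition_def undirected_tree_def)
  interpret K: pair_graph K
    using K by (simp add: connected_subgraph_def)
  have sub: "pverts K \<subseteq> pverts H" "parcs K \<subseteq> parcs H" and conn: "connected (with_proj K)"
    using K by (auto simp: connected_subgraph_def subgraph_def)
  let ?N = "\<lambda>h. {t \<in> pverts T. h \<in> X t}"
  have "connected (with_proj T \<restriction> (\<Union>h\<in>verts (with_proj K). ?N h))"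
  proof (rule T.connected_induce_UN)
    show "wf_digraph (with_proj K)" ..
    show "strongly_connected (with_proj K)"
      using K.sym_arcs conn by (rule K.symmetric_connected_imp_strongly_connected)
    show "connected (with_proj T \<restriction> ?N h)" if "h \<in> verts (with_proj K)" for h
      using td that sub(1) by (auto simp: tree_decomposition_def)
    show "?N h \<inter> ?N h' \<noteq> {}" if "h \<rightarrow>\<^bsub>with_proj K\<^esub> h'" for h h'
    proof -
      have "(h, h') \<in> parcs H"
        using that sub(2) by auto
      then show ?thesis
        using td by (auto simp: tree_decomposition_def)
    qed
  qed auto
  moreover have "(\<Union>h\<in>verts (with_proj K). ?N h) = {t \<in> pverts T. pverts K \<inter> X t \<noteq> {}}"
    by auto
  ultimately show ?thesis by simp
qed

lemma tree_decomposition_of_intersection_model: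
  assumes G: "pair_graph G" and model: "intersection_model G H K" and td: "tree_decomposition H T X"
  shows "tree_decomposition G T (\<lambda>t. {v \<in> pverts G. pverts (K v) \<inter> X t \<noteq> {}})"
    (is "tree_decomposition G T ?Y")
  unfolding tree_decomposition_def
proof (intro conjI ballI)
  interpret G: pair_graph G by (rule G)
  have K: "connected_subgraph (K v) H" "pverts (K v) \<subseteq> pverts H" if "v \<in> pverts G" for v
    using model that by (auto simp: intersection_model_def connected_subgraph_def subgraph_def)
  show "undirected_tree T" using td by (simp add: tree_decomposition_def)
  show "?Y t \<subseteq> pverts G" for t by blast
  show conn: "connected (with_proj T \<restriction> {t \<in> pverts T. v \<in> ?Y t})" if "v \<in> pverts G" for v
    using connected_nodes_meeting_connected_subgraph[OF td K(1)] that by simp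
  show "\<exists>t\<in>pverts T. v \<in> ?Y t" if "v \<in> pverts G" for v
    using connected_nonempty[OF conn[OF that]] by auto
  show "case e of (u, v) \<Rightarrow> \<exists>t\<in>pverts T. u \<in> ?Y t \<and> v \<in> ?Y t" if e: "e \<in> parcs G" for e
  proof (cases e)
    case (Pair u v)
    then have uv: "u \<in> pverts G" "v \<in> pverts G" "u \<noteq> v"
      using e G.wellformed'[of u v] G.no_loops'[of u v] by simp_all
    then obtain h where h: "h \<in> pverts (K u)" "h \<in> pverts (K v)"
      using model e Pair by (auto simp: intersection_model_def)
    then have "h \<in> pverts H"
      using K(2) uv(1) by blast
    then obtain t where "t \<in> pverts T" "h \<in> X t"
      using td unfolding tree_decomposition_def by blast
    then show ?thesis using h Pair uv by auto
  qed
qed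

lemma card_independent_set_in_intersection_bag_le:
  assumes model: "intersection_model G H K" and X: "finite X"
    and I: "independent_set (with_proj G) I" "\<And>v. v \<in> I \<Longrightarrow> pverts (K v) \<inter> X \<noteq> {}"
  shows "card I \<le> card X"
proof -
  have "\<forall>v\<in>I. \<exists>h. h \<in> pverts (K v) \<inter> X"
    using I(2) by blast
  then obtain \<phi> where \<phi>: "\<And>v. v \<in> I \<Longrightarrow> \<phi> v \<in> pverts (K v) \<inter> X"
    by metis
  have "inj_on \<phi> I"
  proof (rule inj_onI, rule ccontr)
    fix u v assume uv: "u \<in> I" "v \<in> I" "\<phi> u = \<phi> v" "u \<noteq> v"
    then have "pverts (K u) \<inter> pverts (K v) \<noteq> {}"
      using \<phi>[of u] \<phi>[of v] by auto
    moreover have "u \<in> pverts G" "v \<in> pverts G" "(u, v) \<notin> parcs G"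
      using I(1) uv by (auto simp: independent_set_def)
    ultimately show False
      using model uv(4) by (auto simp: intersection_model_def)
  qed
  then show ?thesis
    using \<phi> X by (intro card_inj_on_le) auto
qed

lemma (in pair_graph) tree_independence_number_le_intersection_treewidth:
  "tree_independence_number G \<le> intersection_treewidth G + 1"
proof -
  obtain H :: "nat pair_pre_digraph" and K where H: "pair_graph H"
    and tw: "treewidth H \<le> int (intersection_treewidth G)" and model: "intersection_model G H K"
    using intersection_treewidth_attained .
  interpret H: pair_graph H by (rule H)
  obtain T :: "nat pair_pre_digraph" and X where td: "tree_decomposition H T X"
    and width: "decomposition_width T X = treewidth H"
    using H.treewidth_attained .
  show ?thesis
  proof (rule tree_independence_number_le)
    show "tree_decomposition G T (\<lambda>t. {v \<in> pverts G. pverts (K v) \<inter> X t \<noteq> {}})"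
      using pair_graph model td by (rule tree_decomposition_of_intersection_model)
    fix t I assume t: "t \<in> pverts T" and I: "I \<subseteq> {v \<in> pverts G. pverts (K v) \<inter> X t \<noteq> {}}"
      "independent_set (with_proj G) I"
    have "card I \<le> card (X t)"
      using I H.finite_bag[OF td t]
      by (intro card_independent_set_in_intersection_bag_le[OF model]) auto
    then show "card I \<le> intersection_treewidth G + 1"
      using card_bag_le_decomposition_width[OF td t] width tw by linarith
  qed
qed

section \<open>Bounded tree-independence number\<close>

lemma has_bounded_mono:
  assumes "has_bounded \<sigma> \<G>" "mono f" "\<And>G. G \<in> \<G> \<Longrightarrow> \<rho> G \<le> f (\<sigma> G)"
  shows "has_bounded \<rho> \<G>"
  using assms unfolding has_bounded_def mono_def by (meson order_trans)

theorem theorem3p12: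
  fixes \<G> :: "'a pair_pre_digraph set"
  assumes "\<forall>G\<in>\<G>. pair_graph G"
    and "has_bounded treewidth \<G> \<or>
         has_bounded (\<lambda>G. int (independence_number (with_proj G))) \<G> \<or>
         has_bounded (\<lambda>G. int (intersection_treewidth G)) \<G> \<or>
         has_bounded (\<lambda>G. int (max_minimal_separator_size G)) \<G>"
  shows "has_bounded (\<lambda>G. int (tree_independence_number G)) \<G>"
  using assms(2)
proof (elim disjE)
  assume "has_bounded treewidth \<G>"
  then show ?thesis
    by (rule has_bounded_mono[where f = "\<lambda>k. k + 1"])
      (use assms(1) pair_graph.tree_independence_number_le_treewidth in \<open>auto simp: mono_def\<close>)
next
  assume "has_bounded (\<lambda>G. int (independence_number (with_proj G))) \<G>"
  then show ?thesis
    by (rule has_bounded_mono[where f = "\<lambda>k. k"])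
      (use assms(1) pair_graph.tree_independence_number_le_independence_number
        in \<open>auto simp: mono_def\<close>)
next
  assume "has_bounded (\<lambda>G. int (intersection_treewidth G)) \<G>"
  then show ?thesis
    by (rule has_bounded_mono[where f = "\<lambda>k. k + 1"])
      (use assms(1) pair_graph.tree_independence_number_le_intersection_treewidth
        in \<open>fastforce simp: mono_def\<close>)+
next
  assume "has_bounded (\<lambda>G. int (max_minimal_separator_size G)) \<G>"
  moreover have "mono (\<lambda>k. int (max 1 ((nat k)\<^sup>2)))"
    by (intro monoI of_nat_mono max.mono power_mono nat_mono) simp_all
  ultimately show ?thesis
    by (rule has_bounded_mono)
      (use assms(1) pair_graph.tree_independence_number_le_max_minimal_separator_size
        in \<open>auto simp del: of_nat_max of_nat_power\<close>)
qed

end
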